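(* Let $\delta$ be an algebraic integer of degree $2$, let $a,b,g\in\mathbb{Z}$ and let $p$ be a prime number such that $p\mid g$, $g\mid b$ and $p\nmid a$. Let $k$ be a positive integer and write $(a+b\delta)^k=a_k+b_k\delta$ with $a_k,b_k\in\mathbb{Z}$. Let $e$ be the multiplicative order of $a$ modulo $p$ if $p$ is odd, and the multiplicative order of $a$ modulo $4$ if $p=2$. If $p=2$ and $v_2(b)=1$, assume additionally that $k$ is odd. Then the assertions \[ v_p(a_k-1)>v_p(b_k)-v_p(g) \] and \[ \bigl(v_p(a^e-1)-v_p(e)>v_p(b)-v_p(g)\ \text{ and }\ e\mid k\bigr)\quad\text{or}\quad (p,v_2(k),v_2(b/g))=(2,0,0) \] are equivalent.
   Context: $v_p$ denotes the $p$-adic valuation. Since $\delta$ is an algebraic integer of degree $2$, $\mathbb{Z}[\delta]=\mathbb{Z}+\mathbb{Z}\delta$, so integers $a_k,b_k$ as in the statement exist and are unique. *)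

theory Defs
  imports Complex_Main "HOL-Library.Extended_Real" "HOL-Number_Theory.Number_Theory"
    "HOL-Computational_Algebra.Computational_Algebra"
begin

text \<open>
  The library's \<^const>\<open>multiplicity\<close> is 0 at 0, whereas a valuation satisfies
  \<open>v\<^sub>p(0) = \<infinity>\<close>; hence the values in \<^typ>\<open>ereal\<close>.
\<close>

definition padic_val :: "nat \<Rightarrow> int \<Rightarrow> ereal" where
  "padic_val p x = (if x = 0 then \<infinity> else ereal (real (multiplicity (int p) x)))"

text \<open>
  The degree over the rationals, i.e. the degree of the minimal polynomial. Meaningful only
  for algebraic \<open>x\<close>; otherwise the minimum is over the empty set.
\<close>

definition algebraic_degree :: "complex \<Rightarrow> nat" where
  "algebraic_degree x =
     (LEAST d. \<exists>q :: rat poly. q \<noteq> 0 \<and> degree q = d \<and> poly (map_poly of_rat q) x = 0)"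

end

(* Write delta^2 = n + t delta with integers n, t (Gauss' lemma). In the binomial expansion of
   (a + b delta)^k the terms with at least two factors b delta have valuation greater than
   v(k) + v(b), because j C(k,j) = k C(k-1,j-1). Hence v(b_k) = v(k) + v(b), and a_k agrees with a^k
   modulo p^(v(k) + v(b) + 1). As v(g) > 0, the first assertion says that p^(v(k) + c + 1) divides
   a^k - 1, where c = v(b) - v(g). The same binomial estimate, applied to (1 + (a^e - 1))^(k/e),
   lifts the exponent and settles the case e | k. If e does not divide k, the divisibility is only
   possible for p = 2, where 4 does not divide a^k - 1, so v(k) = c = 0. *)
theory Submission
  imports Defs
begin

section \<open>Divisibility by prime powers\<close>

lemma prime_power_dvd_iff:
  fixes p x :: int
  assumes "prime p" "x \<noteq> 0"
  shows "p ^ n dvd x \<longleftrightarrow> n \<le> multiplicity p x"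
  using assms not_prime_unit power_dvd_iff_le_multiplicity by blast

text \<open>Ultrametric principle: a summand of strictly larger valuation does not affect
  divisibility by powers of \<open>p\<close>. The condition on \<open>t\<close> is a divisibility so
  that it covers \<open>t = 0\<close>, where \<open>multiplicity\<close> is 0.\<close>

lemma power_dvd_add_iff:
  fixes p y t :: int
  assumes "prime p" "y \<noteq> 0" "p ^ (multiplicity p y + 1) dvd t"
  shows "p ^ n dvd y + t \<longleftrightarrow> p ^ n dvd y"
proof (cases "n \<le> multiplicity p y")
  case True
  have "p ^ n dvd t"
    using True assms(3) by (meson dvd_trans le_imp_power_dvd trans_le_add1)
  then show ?thesis by (simp add: dvd_add_left_iff)
next
  case False
  have no: "\<not> p ^ (multiplicity p y + 1) dvd y"
    using assms by (subst prime_power_dvd_iff) auto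
  have "p ^ (multiplicity p y + 1) dvd p ^ n"
    using False by (intro le_imp_power_dvd) simp
  then show ?thesis
    using no assms(3) by (meson dvd_add_left_iff dvd_trans)
qed

lemma multiplicity_add_eq:
  fixes p y t :: int
  assumes "prime p" "y \<noteq> 0" "p ^ (multiplicity p y + 1) dvd t"
  shows "y + t \<noteq> 0" and "multiplicity p (y + t) = multiplicity p y"
proof -
  note iff = power_dvd_add_iff[OF assms]
  have "\<not> p ^ (multiplicity p y + 1) dvd y + t"
    unfolding iff using assms by (subst prime_power_dvd_iff) auto
  then show ne: "y + t \<noteq> 0" by auto
  show "multiplicity p (y + t) = multiplicity p y"
    using iff ne assms(1,2) by (metis prime_power_dvd_iff order_antisym order_refl)
qed

section \<open>The binomial estimate\<close>

text \<open>The valuation of C(k,j) is at least v(k) - v(j), which reduces the claim to v(j) + 1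
  \<le> r (j - 1). This follows from p^v(j) \<le> j unless p = 2 and r = 1; in that case k is odd,
  v(k) = 0, and j \<ge> 2 suffices.\<close>

lemma binomial_term_dvd:
  fixes p k j r :: nat and x :: int
  assumes p: "prime p" and k: "k > 0" and j: "j \<ge> 2" and x: "int p ^ r dvd x" and r: "r \<ge> 1"
    and two: "p = 2 \<Longrightarrow> r \<ge> 2 \<or> odd k"
  shows "int p ^ (multiplicity p k + r + 1) dvd int (k choose j) * x ^ j"
proof (cases "j \<le> k")
  case True
  let ?C = "k choose j"
  define v w m where "v = multiplicity p k" and "w = multiplicity p j" and "m = multiplicity p ?C"
  have p2: "p \<ge> 2" using p by (rule prime_ge_2_nat)
  have C: "?C \<noteq> 0" using True by simp
  have "k dvd j * ?C"
    using times_binomial_minus1_eq[of j k] j by simp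
  then have "p ^ v dvd j * ?C"
    unfolding v_def by (meson dvd_trans multiplicity_dvd)
  then have "v \<le> multiplicity p (j * ?C)"
    using C j p2 by (intro multiplicity_geI) auto
  also have "\<dots> = w + m"
    using C j p unfolding w_def m_def
    by (subst prime_elem_multiplicity_mult_distrib) auto
  finally have vwm: "v \<le> w + m" .
  have pw: "p ^ w \<le> j"
    using j multiplicity_dvd[of p j] unfolding w_def by (intro dvd_imp_le) auto
  have bound: "v + r + 1 \<le> m + r * j"
  proof (cases "p = 2 \<and> r = 1")
    case True
    then have "odd k" using two by auto
    then have "v = 0" using True unfolding v_def by (simp add: not_dvd_imp_multiplicity_0)
    then show ?thesis using True j by simp
  next
    case False
    have "w + 1 \<le> r * (j - 1)"
    proof (cases "p = 2")
      case True
      have "w + 1 \<le> 2 ^ w" by (induction w) auto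
      also have "\<dots> \<le> j" using pw True by simp
      also have "\<dots> \<le> 2 * (j - 1)" using j by simp
      also have "\<dots> \<le> r * (j - 1)" using False True r by (intro mult_right_mono) auto
      finally show ?thesis .
    next
      case False
      \<comment> \<open>For odd p the factor r may be 1, so w + 2 \<le> j itself is required. It
        comes from w + 2 \<le> 3^w if w \<ge> 1, and from j \<ge> 2 if w = 0.\<close>
      have "w + 1 \<le> j - 1"
      proof (cases w)
        case 0
        then show ?thesis using j by simp
      next
        case (Suc w')
        have "w' + 3 \<le> 3 ^ Suc w'" by (induction w') auto
        also have "\<dots> \<le> p ^ w" unfolding Suc using False p2 by (intro power_mono) auto
        also have "\<dots> \<le> j" by (rule pw)
        finally show ?thesis using Suc by simp
      qed
      also have "\<dots> \<le> r * (j - 1)" using r by simp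
      finally show ?thesis .
    qed
    moreover have "r * j = r * (j - 1) + r" using j by (cases j) auto
    ultimately show ?thesis using vwm by linarith
  qed
  have "int p ^ m dvd int ?C"
    unfolding m_def by (metis multiplicity_dvd of_nat_dvd_iff of_nat_power)
  moreover have "int p ^ (r * j) dvd x ^ j"
    using x by (simp add: power_mult dvd_power_same)
  ultimately have "int p ^ (m + r * j) dvd int ?C * x ^ j"
    by (simp add: power_add mult_dvd_mono)
  then show ?thesis
    using bound unfolding v_def by (meson dvd_trans le_imp_power_dvd)
qed (simp add: binomial_eq_0)

text \<open>The weights \<open>c\<close> serve two purposes: constant 1 gives (1 + x)^k, while
  powers of a times the coordinates of delta^j give the two coordinates of (a + b delta)^k.\<close>

lemma binomial_sum_cong:
  fixes p k r :: nat and x :: int and c :: "nat \<Rightarrow> int"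
  assumes "prime p" "k > 0" "int p ^ r dvd x" "r \<ge> 1" "p = 2 \<Longrightarrow> r \<ge> 2 \<or> odd k"
  shows "int p ^ (multiplicity p k + r + 1) dvd
    (\<Sum>j\<le>k. int (k choose j) * x ^ j * c j) - (c 0 + int k * x * c 1)"
proof -
  have "{..k} = insert 0 (insert 1 {2..k})" using assms(2) by auto
  then have "(\<Sum>j\<le>k. int (k choose j) * x ^ j * c j) - (c 0 + int k * x * c 1)
      = (\<Sum>j=2..k. int (k choose j) * x ^ j * c j)"
    by simp
  also have "int p ^ (multiplicity p k + r + 1) dvd \<dots>"
    using assms by (intro dvd_sum dvd_mult2 binomial_term_dvd) auto
  finally show ?thesis .
qed

section \<open>Lifting the exponent\<close>

lemma multiplicity_int: "multiplicity (int p) (int n) = multiplicity p n"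
proof -
  have "int p ^ i dvd int n \<longleftrightarrow> p ^ i dvd n" for i
    by (metis of_nat_dvd_iff of_nat_power)
  then show ?thesis by (simp only: multiplicity_def)
qed

text \<open>The binomial estimate makes m x the dominant term of (1 + x)^m - 1. For p = 2 the
  condition 4 | x supplies r \<ge> 2, so m may be even. The divisibility form includes
  \<open>x = 0\<close>.\<close>

lemma lifting_the_exponent:
  fixes p m s :: nat and x :: int
  assumes p: "prime p" and m: "m > 0" and x: "int p dvd x" "p = 2 \<Longrightarrow> 4 dvd x"
  shows "int p ^ (multiplicity p m + s) dvd (1 + x) ^ m - 1 \<longleftrightarrow> int p ^ s dvd x"
proof (cases "x = 0")
  case False
  define r where "r = multiplicity (int p) x"
  have p': "prime (int p)" using p by simp
  have not_unit: "\<not> is_unit (int p)" using p' not_prime_unit by blast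
  have r1: "r \<ge> 1"
    unfolding r_def using False not_unit x(1) by (intro multiplicity_geI) auto
  have r2: "r \<ge> 2" if "p = 2"
    unfolding r_def using False not_unit x(2)[OF that] that by (intro multiplicity_geI) auto
  have mx: "multiplicity (int p) (int m * x) = multiplicity p m + r"
    using False m p' by (subst prime_elem_multiplicity_mult_distrib) (auto simp: r_def multiplicity_int)
  define t where "t = (1 + x) ^ m - 1 - int m * x"
  have "(1 + x) ^ m = (\<Sum>j\<le>m. int (m choose j) * x ^ j * 1)"
    using binomial_ring[of x 1 m] by (simp add: add.commute)
  then have "int p ^ (multiplicity p m + r + 1) dvd t"
    using binomial_sum_cong[of p m r x "\<lambda>_. 1"] p m r1 r2 multiplicity_dvd[of "int p" x]
    by (simp add: t_def r_def algebra_simps)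
  then have "int p ^ (multiplicity p m + s) dvd int m * x + t
      \<longleftrightarrow> int p ^ (multiplicity p m + s) dvd int m * x"
    using False m p' by (intro power_dvd_add_iff) (auto simp: mx)
  also have "\<dots> \<longleftrightarrow> s \<le> r"
    using False m not_unit by (subst power_dvd_iff_le_multiplicity) (auto simp: mx)
  also have "\<dots> \<longleftrightarrow> int p ^ s dvd x"
    using False not_unit by (simp add: power_dvd_iff_le_multiplicity r_def)
  finally show ?thesis by (simp add: t_def)
qed simp

section \<open>Multiplicative orders and the criterion for powers of a\<close>

text \<open>Coprimality and the congruences a^d = 1 depend only on the residue of \<open>a\<close>,
  so a possibly negative \<open>a\<close> may be replaced by its least nonnegative residue. This
  carries over the facts on orders of natural numbers.\<close>

lemma ord_int_eq_ord_nat: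
  assumes "n > 0"
  shows "ord (int n) a = ord n (nat (a mod int n))"
proof -
  have *: "int (nat (a mod int n)) = a mod int n" using assms by (intro nat_0_le) simp
  have "coprime (int n) a \<longleftrightarrow> coprime n (nat (a mod int n))"
    using assms by (metis * coprime_int_iff coprime_mod_right_iff of_nat_0_less_iff less_irrefl)
  moreover have "[a ^ d = 1] (mod int n) \<longleftrightarrow> [nat (a mod int n) ^ d = 1] (mod n)" for d
  proof -
    have "[a ^ d = 1] (mod int n) \<longleftrightarrow> [(a mod int n) ^ d = 1] (mod int n)"
      by (simp add: cong_def power_mod)
    also have "\<dots> \<longleftrightarrow> [int (nat (a mod int n) ^ d) = int 1] (mod int n)"
      by (simp only: of_nat_power * of_nat_1)
    finally show ?thesis by (simp only: cong_int_iff)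
  qed
  ultimately show ?thesis by (simp add: ord_def)
qed

lemma ord_int_divides:
  assumes "n > 0"
  shows "int n dvd a ^ d - 1 \<longleftrightarrow> ord (int n) a dvd d"
proof -
  have *: "int (nat (a mod int n)) = a mod int n" using assms by (intro nat_0_le) simp
  have "int n dvd a ^ d - 1 \<longleftrightarrow> [(a mod int n) ^ d = 1] (mod int n)"
    by (simp add: cong_iff_dvd_diff [symmetric] cong_def power_mod)
  also have "\<dots> \<longleftrightarrow> [int (nat (a mod int n) ^ d) = int 1] (mod int n)"
    by (simp only: of_nat_power * of_nat_1)
  also have "\<dots> \<longleftrightarrow> ord (int n) a dvd d"
    by (simp only: cong_int_iff ord_divides ord_int_eq_ord_nat[OF assms])
  finally show ?thesis .
qed

lemma ord_int_pos:
  assumes "n > 0" "coprime (int n) a"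
  shows "ord (int n) a > 0"
  using assms ord_gt_0_iff[of n "nat (a mod int n)"]
  by (simp add: ord_int_eq_ord_nat) 
     (metis coprime_int_iff coprime_mod_right_iff int_nat_eq of_nat_0_less_iff pos_mod_sign less_irrefl)

text \<open>This is the equivalence left once delta has been eliminated; \<open>c\<close> stands for
  v(b) - v(g).\<close>

lemma power_minus_one_criterion:
  fixes p k e c :: nat and a :: int
  assumes p: "prime p" and a: "\<not> int p dvd a" and k: "k > 0"
    and e: "e = (if p = 2 then ord 4 a else ord (int p) a)"
  shows "int p ^ (multiplicity p k + c + 1) dvd a ^ k - 1 \<longleftrightarrow>
    (int p ^ (multiplicity p e + c + 1) dvd a ^ e - 1 \<and> e dvd k) \<or> (p = 2 \<and> odd k \<and> c = 0)"
proof -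
  \<comment> \<open>\<open>q\<close> is the modulus defining \<open>e\<close>. Divisibility of a^e -
    1 by \<open>q\<close> is also exactly what \<open>lifting_the_exponent\<close> requires of its
    \<open>x\<close>.\<close>
  define q where "q = (if p = 2 then 4 else p)"
  have q: "q > 0" using p by (auto simp: q_def prime_gt_0_nat)
  have pq: "int p dvd int q" by (auto simp: q_def)
  have e': "e = ord (int q) a" by (simp add: e q_def)
  have divs: "int q dvd a ^ d - 1 \<longleftrightarrow> e dvd d" for d
    unfolding e' by (rule ord_int_divides[OF q])
  have "coprime (int p) a" using p a by (simp add: prime_imp_coprime)
  then have "coprime (int (p ^ 2)) a"
    by (simp only: of_nat_power coprime_power_left_iff) simp
  then have "coprime (int q) a"
    using \<open>coprime (int p) a\<close> by (cases "p = 2") (simp_all add: q_def)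
  then have e0: "e > 0" unfolding e' by (rule ord_int_pos[OF q])
  have qe: "int q dvd a ^ e - 1" by (simp add: divs)
  show ?thesis
  proof (cases "e dvd k")
    case True
    then obtain m where m: "k = e * m" by blast
    with k have m0: "m > 0" by auto
    have vk: "multiplicity p k = multiplicity p m + multiplicity p e"
      unfolding m using p e0 m0 by (subst prime_elem_multiplicity_mult_distrib) auto
    have "int p ^ (multiplicity p m + (multiplicity p e + c + 1)) dvd (1 + (a ^ e - 1)) ^ m - 1
        \<longleftrightarrow> int p ^ (multiplicity p e + c + 1) dvd a ^ e - 1"
      using p m0 qe pq dvd_trans by (intro lifting_the_exponent) (auto simp: q_def)
    moreover have "a ^ k = (1 + (a ^ e - 1)) ^ m"
      by (simp add: m power_mult)
    ultimately have "int p ^ (multiplicity p k + c + 1) dvd a ^ k - 1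
        \<longleftrightarrow> int p ^ (multiplicity p e + c + 1) dvd a ^ e - 1"
      by (simp only: vk add.assoc)
    \<comment> \<open>When e | k, the exceptional alternative is absorbed by the first one: e is odd
      with k, so the exponent is just 1.\<close>
    moreover have "int p ^ (multiplicity p e + c + 1) dvd a ^ e - 1" if "p = 2" "odd k" "c = 0"
    proof -
      have "odd e" using that True by (meson dvd_trans)
      then have "multiplicity p e = 0" using that by (simp add: not_dvd_imp_multiplicity_0)
      then show ?thesis using that dvd_trans[OF pq qe] by simp
    qed
    ultimately show ?thesis using True by blast
  next
    case False
    then have no: "\<not> int q dvd a ^ k - 1" by (simp add: divs)
    show ?thesis
    proof (cases "p = 2")
      case True
      then have "odd a" using a by simp
      then have even: "int p dvd a ^ k - 1" using True by simp
      \<comment> \<open>Here a^k - 1 is even but not divisible by 4, so exactly one factor 2 is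
        available.\<close>
      have "int p ^ (multiplicity p k + c + 1) dvd a ^ k - 1 \<longleftrightarrow> multiplicity p k + c + 1 \<le> 1"
        (is "_ ^ ?n dvd _ \<longleftrightarrow> _")
      proof (cases "?n \<le> 1")
        case True
        then show ?thesis using even by simp
      next
        case False
        have "(2 :: int) ^ 2 dvd 2 ^ ?n"
          using False by (intro le_imp_power_dvd) linarith
        then have "int q dvd int p ^ ?n"
          using \<open>p = 2\<close> by (simp add: q_def)
        then show ?thesis using no False by (meson dvd_trans)
      qed
      moreover have "multiplicity p k = 0 \<longleftrightarrow> odd k"
        using True k by (simp add: multiplicity_eq_zero_iff)
      ultimately show ?thesis using \<open>\<not> e dvd k\<close> True by simp
    next
      case p_odd: False
      then have "\<not> int p ^ (multiplicity p k + c + 1) dvd a ^ k - 1"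
        using no dvd_mult_left[of "int p"] by (auto simp: q_def)
      then show ?thesis using p_odd False by simp
    qed
  qed
qed

section \<open>Integer polynomials and the degree of an algebraic integer\<close>

lemma of_int_poly_add:
  "poly (map_poly of_int (p + q)) (x :: complex) = poly (map_poly of_int p) x + poly (map_poly of_int q) x"
  by (induction p q rule: poly_induct2) (simp_all add: map_poly_pCons algebra_simps)

lemma of_int_poly_smult:
  "poly (map_poly of_int (smult c q)) (x :: complex) = of_int c * poly (map_poly of_int q) x"
  by (simp add: map_poly_smult)

lemma of_int_poly_mult:
  "poly (map_poly of_int (p * q)) (x :: complex) = poly (map_poly of_int p) x * poly (map_poly of_int q) x"
proof (induction p)
  case (pCons c p)
  then show ?case
    by (simp add: mult_pCons_left of_int_poly_add of_int_poly_smult map_poly_pCons algebra_simps)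
qed simp

text \<open>Induction on the coefficients, collecting denominators in \<open>m\<close>. The clause
  on \<open>q' = 0\<close> is needed in the induction because the degree alone does not separate 0
  from the other constants.\<close>

lemma rat_poly_clear_denominators:
  fixes q :: "rat poly"
  shows "\<exists>m q'. m \<noteq> 0 \<and> degree q' = degree q \<and> (q' = 0 \<longleftrightarrow> q = 0) \<and>
    (\<forall>x :: complex. poly (map_poly of_int q') x = of_int m * poly (map_poly of_rat q) x)"
proof (induction q)
  case 0
  show ?case by (intro exI[of _ 1] exI[of _ 0]) simp
next
  case (pCons c q)
  then obtain m q' where IH: "m \<noteq> 0" "degree q' = degree q" "q' = 0 \<longleftrightarrow> q = 0"
    "\<And>x :: complex. poly (map_poly of_int q') x = of_int m * poly (map_poly of_rat q) x"
    by auto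
  obtain y z where c: "c = of_int y / of_int z" "z \<noteq> 0"
    by (metis quotient_of_div quotient_of_denom_pos less_irrefl surj_pair)
  have "(of_rat c :: complex) = of_int y / of_int z"
    by (simp add: c of_rat_divide)
  then have "poly (map_poly of_int (pCons (m * y) (smult z q'))) x =
      of_int (m * z) * poly (map_poly of_rat (pCons c q)) x" for x :: complex
    using c(2) by (simp add: map_poly_pCons of_int_poly_smult IH(4) algebra_simps)
  moreover have "degree (pCons (m * y) (smult z q')) = degree (pCons c q)"
    using IH c by (simp add: degree_pCons_eq_if)
  moreover have "pCons (m * y) (smult z q') = 0 \<longleftrightarrow> pCons c q = 0"
    using IH c by simp
  ultimately show ?case
    using IH(1) c(2) by (intro exI[of _ "m * z"] exI[of _ "pCons (m * y) (smult z q')"]) simp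
qed

lemma algebraic_degree_le:
  fixes q :: "int poly"
  assumes "q \<noteq> 0" "poly (map_poly of_int q) x = 0"
  shows "algebraic_degree x \<le> degree q"
  unfolding algebraic_degree_def
proof (rule Least_le, intro exI conjI)
  show "map_poly of_int q \<noteq> (0 :: rat poly)" using assms(1) by (simp add: map_poly_eq_0_iff)
  show "degree (map_poly of_int q :: rat poly) = degree q" by (simp add: degree_map_poly)
  show "poly (map_poly of_rat (map_poly of_int q)) x = 0"
    using assms(2) by (simp add: map_poly_map_poly o_def)
qed

text \<open>Integrality makes the set under \<open>LEAST\<close> nonempty, so the minimum is
  attained; clearing denominators keeps its degree.\<close>

lemma algebraic_degree_witness:
  assumes "algebraic_int x"
  obtains q :: "int poly"
  where "q \<noteq> 0" "degree q = algebraic_degree x" "poly (map_poly of_int q) x = 0"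
proof -
  from assms obtain P :: "int poly" where P: "poly (map_poly of_int P) x = 0" "lead_coeff P = 1"
    by (auto simp: algebraic_int_altdef_ipoly)
  have "\<exists>d. \<exists>q :: rat poly. q \<noteq> 0 \<and> degree q = d \<and> poly (map_poly of_rat q) x = 0"
    using P by (intro exI[of _ "degree P"] exI[of _ "map_poly of_int P"])
      (auto simp: map_poly_eq_0_iff degree_map_poly map_poly_map_poly o_def)
  then have "\<exists>q :: rat poly. q \<noteq> 0 \<and> degree q = algebraic_degree x \<and> poly (map_poly of_rat q) x = 0"
    unfolding algebraic_degree_def by (rule LeastI_ex)
  then show ?thesis
    using rat_poly_clear_denominators that by (metis mult_zero_right)
qed

text \<open>Gauss' lemma: comparing contents in a pseudo-division of the monic polynomial by a
  primitive one of minimal degree shows that the latter has a unit as its leading coefficient.\<close>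
lemma algebraic_int_minimal_poly_unit_lead_coeff:
  assumes "algebraic_int x"
  obtains q :: "int poly"
  where "degree q = algebraic_degree x" "poly (map_poly of_int q) x = 0" "is_unit (lead_coeff q)"
proof -
  from assms obtain P :: "int poly" where P: "poly (map_poly of_int P) x = 0" "lead_coeff P = 1"
    by (auto simp: algebraic_int_altdef_ipoly)
  from algebraic_degree_witness[OF assms] obtain q0 :: "int poly"
    where q0: "q0 \<noteq> 0" "degree q0 = algebraic_degree x" "poly (map_poly of_int q0) x = 0" .
  define q where "q = primitive_part q0"
  have q: "q \<noteq> 0" "degree q = algebraic_degree x" "content q = 1"
    using q0 by (simp_all add: q_def)
  have root: "poly (map_poly of_int q) x = 0"
    using q0 of_int_poly_smult[of "content q0" q x] by (simp add: q_def)
  define r where "r = pseudo_mod P q"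
  from pseudo_mod[OF q(1), of P] obtain c s
    where c: "c \<noteq> 0" and div: "smult c P = q * s + r" and r: "r = 0 \<or> degree r < degree q"
    by (auto simp: r_def)
  have "poly (map_poly of_int r) x = 0"
    using arg_cong[OF div, of "\<lambda>f. poly (map_poly of_int f) x"] P(1) root
    by (simp add: of_int_poly_add of_int_poly_mult of_int_poly_smult)
  \<comment> \<open>A nonzero remainder would vanish at x with degree below the minimum.\<close>
  then have "r = 0"
    using algebraic_degree_le[of r x] r q(2) by linarith
  then have div: "smult c P = q * s" using div by simp
  have "content P = 1"
    using content_dvd_coeff[of P "degree P"] P(2) by (simp flip: is_unit_content_iff)
  then have "content s = normalize c"
    using arg_cong[OF div, of content] q(3) by (simp add: content_mult)
  then have "c dvd lead_coeff s"
    using content_dvd_coeff[of s "degree s"] by simp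
  then obtain z where z: "lead_coeff s = c * z" by blast
  have "c = lead_coeff q * lead_coeff s"
    using arg_cong[OF div, of lead_coeff] P(2) by (simp only: lead_coeff_mult lead_coeff_smult mult_1_right)
  then have "lead_coeff q * z = 1"
    using c by (simp add: z mult.left_commute)
  then have "is_unit (lead_coeff q)" by (metis dvdI)
  with q(2) root that show ?thesis by blast
qed

section \<open>Coordinates with respect to 1 and delta\<close>

lemma quadratic_integer_square:
  assumes "algebraic_int \<delta>" "algebraic_degree \<delta> = 2"
  obtains n t :: int where "\<delta> ^ 2 = of_int n + of_int t * \<delta>"
proof -
  obtain q :: "int poly" where q: "degree q = 2" "poly (map_poly of_int q) \<delta> = 0" "is_unit (lead_coeff q)"
    using algebraic_int_minimal_poly_unit_lead_coeff[OF assms(1)] assms(2) by metis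
  define u where "u = coeff q 2"
  \<comment> \<open>The leading coefficient is 1 or -1, so multiplying the relation by
    \<open>u\<close> makes it monic.\<close>
  have u: "u * u = 1" using q(1,3) by (auto simp: u_def zdvd1_eq abs_if split: if_splits)
  have "of_int (coeff q 0) + of_int (coeff q 1) * \<delta> + of_int u * \<delta> ^ 2 = 0"
    using q(1,2) by (simp add: poly_altdef degree_map_poly coeff_map_poly u_def numeral_2_eq_2)
  then have "of_int u * (of_int (coeff q 0) + of_int (coeff q 1) * \<delta> + of_int u * \<delta> ^ 2) = 0"
    by simp
  then have "of_int u * (of_int (coeff q 0) + of_int (coeff q 1) * \<delta>) + of_int (u * u) * \<delta> ^ 2 = 0"
    by (simp only: of_int_mult distrib_left mult.assoc)
  then have "\<delta> ^ 2 = of_int (- u * coeff q 0) + of_int (- u * coeff q 1) * \<delta>"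
    unfolding u by (simp add: algebra_simps eq_neg_iff_add_eq_0)
  with that show ?thesis by blast
qed

text \<open>Otherwise the difference is a nonzero integer polynomial of degree at most 1 with root
  delta.\<close>

lemma quadratic_independent:
  assumes "algebraic_degree \<delta> = 2" "of_int a + of_int b * \<delta> = of_int c + of_int d * \<delta>"
  shows "a = c \<and> b = d"
proof -
  have "[:a - c, b - d:] = 0"
  proof (rule ccontr)
    assume ne: "[:a - c, b - d:] \<noteq> 0"
    have "poly (map_poly of_int [:a - c, b - d:]) \<delta> = 0"
      using assms(2) by (simp add: map_poly_pCons algebra_simps)
    from algebraic_degree_le[OF ne this] show False
      using assms(1) by (simp add: degree_pCons_eq_if split: if_splits)
  qed
  then show ?thesis by simp
qed

text \<open>The values at 0 and 1 will single out the main terms a^k and k b a^(k-1); of the later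
  values only integrality matters.\<close>

lemma quadratic_power_coordinates:
  assumes "algebraic_int \<delta>" "algebraic_degree \<delta> = 2"
  obtains w u :: "nat \<Rightarrow> int"
  where "\<And>j. \<delta> ^ j = of_int (w j) + of_int (u j) * \<delta>" "w 0 = 1" "u 0 = 0" "w 1 = 0" "u 1 = 1"
proof -
  obtain n t :: int where sq: "\<delta> ^ 2 = of_int n + of_int t * \<delta>"
    using quadratic_integer_square[OF assms] .
  have "\<exists>w u :: int. \<delta> ^ j = of_int w + of_int u * \<delta>" for j
  proof (induction j)
    case 0
    show ?case by (intro exI[of _ 1] exI[of _ 0]) simp
  next
    case (Suc j)
    then obtain w u :: int where "\<delta> ^ j = of_int w + of_int u * \<delta>" by blast
    then have "\<delta> ^ Suc j = of_int w * \<delta> + of_int u * \<delta> ^ 2"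
      by (simp add: algebra_simps power2_eq_square)
    also have "\<dots> = of_int (u * n) + of_int (w + u * t) * \<delta>"
      by (simp add: sq algebra_simps)
    finally show ?case by blast
  qed
  then obtain w u where wu: "\<And>j. \<delta> ^ j = of_int (w j :: int) + of_int (u j :: int) * \<delta>"
    by metis
  have "w 0 = 1 \<and> u 0 = 0"
    using wu[of 0] by (intro quadratic_independent[OF assms(2)]) simp
  moreover have "w 1 = 0 \<and> u 1 = 1"
    using wu[of 1] by (intro quadratic_independent[OF assms(2)]) simp
  ultimately show ?thesis using wu that by blast
qed

lemma quadratic_power_coefficients:
  fixes p k r :: nat and a b ak bk :: int
  assumes d: "algebraic_int \<delta>" "algebraic_degree \<delta> = 2"
    and eq: "(of_int a + of_int b * \<delta>) ^ k = of_int ak + of_int bk * \<delta>"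
    and p: "prime p" "k > 0" "int p ^ r dvd b" "r \<ge> 1" "p = 2 \<Longrightarrow> r \<ge> 2 \<or> odd k"
  shows "int p ^ (multiplicity p k + r + 1) dvd ak - a ^ k"
    and "int p ^ (multiplicity p k + r + 1) dvd bk - int k * b * a ^ (k - 1)"
proof -
  obtain w u where wu: "\<And>j. \<delta> ^ j = of_int (w j :: int) + of_int (u j :: int) * \<delta>"
    and init: "w 0 = 1" "u 0 = 0" "w 1 = 0" "u 1 = 1"
    using quadratic_power_coordinates[OF d] by metis
  \<comment> \<open>\<open>S w\<close> and \<open>S u\<close> are the coordinates of the expanded
    power along 1 and delta, arranged to fit \<open>binomial_sum_cong\<close>.\<close>
  define S where "S f = (\<Sum>j\<le>k. int (k choose j) * b ^ j * (a ^ (k - j) * f j))" for f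
  have "(of_int a + of_int b * \<delta>) ^ k
      = (\<Sum>j\<le>k. of_nat (k choose j) * (of_int b * \<delta>) ^ j * of_int a ^ (k - j))"
    using binomial_ring[of "of_int b * \<delta>" "of_int a" k] by (simp add: add.commute)
  also have "\<dots> = of_int (S w) + of_int (S u) * \<delta>"
    by (simp add: S_def power_mult_distrib wu sum_distrib_right flip: sum.distrib)
      (simp add: algebra_simps)
  finally have "ak = S w \<and> bk = S u"
    using eq by (intro quadratic_independent[OF d(2)]) simp
  then show "int p ^ (multiplicity p k + r + 1) dvd ak - a ^ k"
    and "int p ^ (multiplicity p k + r + 1) dvd bk - int k * b * a ^ (k - 1)"
    using binomial_sum_cong[OF p, of "\<lambda>j. a ^ (k - j) * w j"]
      binomial_sum_cong[OF p, of "\<lambda>j. a ^ (k - j) * u j"] init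
    by (simp_all add: S_def)
qed

section \<open>From valuations to divisibility, and the equivalence\<close>

text \<open>The strict inequality causes the shift to n + 1. At \<open>x = 0\<close> both sides
  hold, the valuation being infinite.\<close>

lemma padic_val_greater_iff:
  assumes "prime p"
  shows "padic_val p x > ereal (real n) \<longleftrightarrow> int p ^ (n + 1) dvd x"
  using assms by (cases "x = 0") (simp_all add: padic_val_def prime_power_dvd_iff Suc_le_eq del: power_Suc)

theorem theorem2p9:
  fixes \<delta> :: complex and a b g :: int and p k e :: nat and ak bk :: int
  assumes "algebraic_int \<delta>" and "algebraic_degree \<delta> = 2"
    and "prime p" and "int p dvd g" and "g dvd b" and "\<not> int p dvd a"
    and "k > 0"
    and "(of_int a + of_int b * \<delta>) ^ k = of_int ak + of_int bk * \<delta>"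
    and "e = (if p = 2 then ord 4 a else ord (int p) a)"
    and "p = 2 \<and> padic_val 2 b = 1 \<longrightarrow> odd k"
  shows "padic_val p (ak - 1) > padic_val p bk - padic_val p g \<longleftrightarrow>
     (padic_val p (a ^ e - 1) - padic_val p (int e) > padic_val p b - padic_val p g \<and> e dvd k) \<or>
     (p, padic_val 2 (int k), padic_val 2 (b div g)) = (2, 0, 0)"
proof (cases "b = 0")
  case True
  have "of_int (a ^ k) + of_int 0 * \<delta> = of_int ak + of_int bk * \<delta>"
    using assms(8) True by simp
  then have "bk = 0"
    using quadratic_independent[OF assms(2)] by metis
  \<comment> \<open>Both sides are false: infinity minus anything is infinity in
    \<open>ereal\<close>, even if \<open>g = 0\<close>, and \<open>b div g = 0\<close> has infinite
    valuation.\<close>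
  then show ?thesis using True by (simp add: padic_val_def)
next
  case False
  note p = assms(3)
  have p': "prime (int p)" using p by simp
  have not_unit: "\<not> is_unit (int p)" using p' not_prime_unit by blast
  have g0: "g \<noteq> 0" using False assms(5) by auto
  define r s c where "r = multiplicity (int p) b" and "s = multiplicity (int p) g" and "c = r - s"
  have s1: "s \<ge> 1"
    unfolding s_def using g0 not_unit assms(4) by (intro multiplicity_geI) auto
  have sr: "s \<le> r"
    unfolding s_def r_def using False assms(5) by (intro dvd_imp_multiplicity_le)
  have rb: "int p ^ r dvd b" unfolding r_def by (rule multiplicity_dvd)
  \<comment> \<open>The extra assumption for v(b) = 1 is the side condition of the binomial estimate
    at p = 2.\<close>
  have two: "r \<ge> 2 \<or> odd k" if "p = 2"
    using assms(10) that False s1 sr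
    by (cases "r = 1") (auto simp: padic_val_def r_def one_ereal_def)
  have r1: "r \<ge> 1" using s1 sr by simp
  note coeffs = quadratic_power_coefficients[OF assms(1,2,8) p assms(7) rb r1 two]

  have a0: "a \<noteq> 0" using assms(6) by auto
  have m: "multiplicity (int p) (int k * b * a ^ (k - 1)) = multiplicity p k + r"
    using p' False a0 assms(6,7)
    by (simp add: prime_elem_multiplicity_mult_distrib prime_elem_multiplicity_power_distrib
        multiplicity_int r_def not_dvd_imp_multiplicity_0)
  have main: "int k * b * a ^ (k - 1) \<noteq> 0" using False a0 assms(7) by simp
  \<comment> \<open>The error is divisible by one more power of p than the main term. Nonvanishing
    of \<open>bk\<close> keeps its valuation finite.\<close>
  have bk: "bk \<noteq> 0" "multiplicity (int p) bk = multiplicity p k + r"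
    using multiplicity_add_eq[OF p' main, of "bk - int k * b * a ^ (k - 1)"] coeffs(2)
    unfolding m by simp_all
  have val_bk: "padic_val p bk - padic_val p g = ereal (real (multiplicity p k + c))"
    using bk g0 sr by (simp add: padic_val_def c_def flip: s_def)
  have val_b: "padic_val p b - padic_val p g = ereal (real c)"
    using False g0 sr by (simp add: padic_val_def c_def flip: s_def r_def)

  \<comment> \<open>As c \<le> r, the congruence for a_k is strong enough to replace a_k by
    a^k.\<close>
  have "int p ^ (multiplicity p k + c + 1) dvd ak - a ^ k"
    using coeffs(1) by (rule dvd_trans[rotated]) (auto simp: c_def intro!: le_imp_power_dvd)
  then have "int p ^ (multiplicity p k + c + 1) dvd (a ^ k - 1) + (ak - a ^ k)
      \<longleftrightarrow> int p ^ (multiplicity p k + c + 1) dvd a ^ k - 1"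
    by (rule dvd_add_left_iff)
  then have lhs: "padic_val p (ak - 1) > padic_val p bk - padic_val p g \<longleftrightarrow>
      int p ^ (multiplicity p k + c + 1) dvd a ^ k - 1"
    unfolding val_bk padic_val_greater_iff[OF p] by simp

  have "e > 0"
  proof -
    have cop: "coprime (int p) a" using p assms(6) by (simp add: prime_imp_coprime)
    show ?thesis
      using ord_int_pos[of p a] ord_int_pos[of 4 a] cop p assms(9)
        coprime_power_left_iff[of 2 2 a]
      by (auto simp: prime_gt_0_nat)
  qed
  \<comment> \<open>Positivity of \<open>e\<close> makes its valuation finite, so it can be moved
    across; if a^e = 1, both sides hold.\<close>
  then have "padic_val p (a ^ e - 1) - padic_val p (int e) > ereal (real c) \<longleftrightarrow>
      padic_val p (a ^ e - 1) > ereal (real (multiplicity p e + c))"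
    by (cases "a ^ e = 1") (auto simp: padic_val_def multiplicity_int)
  then have rhs: "padic_val p (a ^ e - 1) - padic_val p (int e) > padic_val p b - padic_val p g \<longleftrightarrow>
      int p ^ (multiplicity p e + c + 1) dvd a ^ e - 1"
    unfolding val_b padic_val_greater_iff[OF p] .

  have exceptional: "(p, padic_val 2 (int k), padic_val 2 (b div g)) = (2, 0, 0) \<longleftrightarrow>
      p = 2 \<and> odd k \<and> c = 0"
  proof (cases "p = 2")
    case True
    have "b div g \<noteq> 0" using False assms(5) by auto
    moreover have "multiplicity (int p) (b div g * g) = multiplicity (int p) (b div g) + s"
      using p' calculation g0 by (simp add: prime_elem_multiplicity_mult_distrib s_def)
    then have "multiplicity 2 (b div g) = c"
      using assms(5) True sr by (simp add: c_def r_def)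
    moreover have "multiplicity 2 (int k) = 0 \<longleftrightarrow> odd k"
      using assms(7) by (simp add: multiplicity_eq_zero_iff)
    ultimately show ?thesis
      using True assms(7) by (simp add: padic_val_def zero_ereal_def)
  qed simp

  show ?thesis
    unfolding lhs rhs exceptional
    using power_minus_one_criterion[OF p assms(6,7,9)] .
qed

end
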